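(* Let $\beta$ be a closed bounded piecewise-smooth curve in the plane $\mathbb{R}^2$ with the following properties: 1. $\beta$ has an even number of smooth arcs separated by $n$ ordinary cusps; 2. the alternating oriented tangent line of $\beta$ completes a single clockwise rotation in traversing $\beta$ once with respect to the standard orientation. Then the rotation index $i$ of $\beta$ satisfies $i=(n-2)/2$.
   Context: An ordinary cusp is a semicubical cusp; the two arcs meeting there have a common tangent line and the unit tangent vector reverses direction when passing through it. Local convexity of the arcs is not assumed. The standard orientation of $\beta$ is the chosen direction of traversal of the closed curve, with respect to which property 2 and the rotation index are both measured. Let $T$ be the unit tangent vector of $\beta$ with respect to the standard orientation (defined on each smooth arc). The alternating orientation: let $t$ be the unit tangent vector field along $\beta$ which equals $T$ on every second arc and $-T$ on the remaining arcs (the sign alternating at each cusp; this is consistent because the number of arcs is even). Since $T$ reverses at each cusp, $t$ extends continuously through the cusps and around $\beta$. The alternating oriented tangent line is the tangent line oriented by $t$; let $\Phi$ be the continuous angle it makes with a fixed direction, measured anticlockwise. Property 2 says that the total change of $\Phi$ on traversing $\beta$ once in the standard orientation is $-2\pi$. Rotation index: let $\phi$ be the angle that $T$ makes with the fixed direction, measured anticlockwise. The rotation index $i$ is defined by $2\pi i=\sum_{j=1}^n(\delta\phi)_j+n\pi$, where $(\delta\phi)_j$ is the signed total change of $\phi$ along the $j$th smooth arc; that is, by convention the tangent vector rotates by $+\pi$ at each of the $n$ cusps. *)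

theory Defs
  imports "HOL-Analysis.Analysis"
begin

definition nth_vderiv :: "nat \<Rightarrow> (real \<Rightarrow> real^2) \<Rightarrow> real \<Rightarrow> real^2" where
  "nth_vderiv k f = ((\<lambda>g x. vector_derivative g (at x)) ^^ k) f"

(* Only meant for open S: all derivatives are two-sided. *)
definition smooth_on :: "real set \<Rightarrow> (real \<Rightarrow> real^2) \<Rightarrow> bool" where
  "smooth_on S f \<longleftrightarrow> (\<forall>k. \<forall>x\<in>S. nth_vderiv k f differentiable (at x))"

(* The classical criterion for a semicubical cusp: the first derivative vanishes and the second
   and third ones are linearly independent. It refers to a smooth local parametrization, which
   need not be the given one (arc length, for instance, is not smooth at a cusp); h is the
   orientation-preserving change of parameter, regular except possibly at the cusp itself.
   The inequality of the two vectors is needed because {v, v} = {v} may be independent.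
   That the unit tangent vector reverses at the cusp is a consequence. *)
definition ordinary_cusp :: "(real \<Rightarrow> real^2) \<Rightarrow> real \<Rightarrow> bool" where
  "ordinary_cusp \<beta> c \<longleftrightarrow>
     (\<exists>h e. e > 0 \<and> h 0 = c \<and> continuous_on {-e<..<e} h \<and>
        (\<forall>u\<in>{-e<..<e} - {0}. \<exists>h'>0. (h has_real_derivative h') (at u)) \<and>
        smooth_on {-e<..<e} (\<beta> \<circ> h) \<and>
        nth_vderiv 1 (\<beta> \<circ> h) 0 = 0 \<and>
        nth_vderiv 2 (\<beta> \<circ> h) 0 \<noteq> nth_vderiv 3 (\<beta> \<circ> h) 0 \<and>
        independent {nth_vderiv 2 (\<beta> \<circ> h) 0, nth_vderiv 3 (\<beta> \<circ> h) 0})"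

(* A closed curve is a periodic map; its standard orientation is that of increasing parameter.
   The base point s 0 is taken to be a cusp, so that the n smooth arcs are the images of
   the intervals from s j to s (Suc j), j < n, and s n is again the cusp s 0.
   Boundedness is implied by continuity and periodicity. *)
definition closed_cuspidal_curve :: "(real \<Rightarrow> real^2) \<Rightarrow> (nat \<Rightarrow> real) \<Rightarrow> nat \<Rightarrow> bool" where
  "closed_cuspidal_curve \<beta> s n \<longleftrightarrow>
     n > 0 \<and> strict_mono_on {..n} s \<and>
     continuous_on UNIV \<beta> \<and> (\<forall>x. \<beta> (x + (s n - s 0)) = \<beta> x) \<and> bounded (range \<beta>) \<and>
     (\<forall>j<n. smooth_on {s j<..<s (Suc j)} \<beta> \<and>
            (\<forall>x\<in>{s j<..<s (Suc j)}. vector_derivative \<beta> (at x) \<noteq> 0)) \<and>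
     (\<forall>j<n. ordinary_cusp \<beta> (s j))"

definition unit_tangent :: "(real \<Rightarrow> real^2) \<Rightarrow> real \<Rightarrow> real^2" where
  "unit_tangent \<beta> x = sgn (vector_derivative \<beta> (at x))"

(* For x strictly between s j and s (Suc j) the exponent is j. *)
definition alternating_tangent :: "(real \<Rightarrow> real^2) \<Rightarrow> (nat \<Rightarrow> real) \<Rightarrow> real \<Rightarrow> real^2" where
  "alternating_tangent \<beta> s x = (-1) ^ (LEAST j. x < s (Suc j)) *\<^sub>R unit_tangent \<beta> x"

(* d is the total change over [a, b] of a continuous anticlockwise angle \<theta> from the positive
   first coordinate axis to v. The field v is not evaluated at the exceptional (cusp) parameters
   in C; continuity of \<theta> there expresses that v extends continuously. *)
definition has_angle_change ::
    "(real \<Rightarrow> real^2) \<Rightarrow> real set \<Rightarrow> real \<Rightarrow> real \<Rightarrow> real \<Rightarrow> bool" where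
  "has_angle_change v C a b d \<longleftrightarrow>
     (\<exists>\<theta>. continuous_on {a..b} \<theta> \<and>
          (\<forall>x\<in>{a..b} - C. v x = vector [cos (\<theta> x), sin (\<theta> x)]) \<and>
          d = \<theta> b - \<theta> a)"

definition angle_change :: "(real \<Rightarrow> real^2) \<Rightarrow> real set \<Rightarrow> real \<Rightarrow> real \<Rightarrow> real" where
  "angle_change v C a b = (THE d. has_angle_change v C a b d)"

definition cusp_params :: "(nat \<Rightarrow> real) \<Rightarrow> nat \<Rightarrow> real set" where
  "cusp_params s n = s ` {..n}"

(* The summand n * pi is the convention that the tangent turns by +pi at each cusp. *)
definition rotation_index :: "(real \<Rightarrow> real^2) \<Rightarrow> (nat \<Rightarrow> real) \<Rightarrow> nat \<Rightarrow> real" where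
  "rotation_index \<beta> s n =
     ((\<Sum>j<n. angle_change (unit_tangent \<beta>) (cusp_params s n) (s j) (s (Suc j))) + real n * pi)
       / (2 * pi)"

end

theory Submission
  imports Defs
begin

text \<open>On each arc the unit tangent is \<open>\<plusminus>\<close> the alternating tangent, so an angle function of the
  alternating tangent, shifted by a multiple of \<open>\<pi>\<close>, is one of the unit tangent. Hence the angle
  changes of the unit tangent along the arcs telescope to the total change \<open>-2 * pi\<close>.\<close>

text \<open>Two angle functions of the same field differ by \<open>2 * pi\<close> times an integer
  wherever the field is evaluated. On an interval whose interior avoids \<open>C\<close>, continuity
  forces this integer to be constant, so it cancels in the difference of the end values.\<close>

lemma has_angle_change_unique:
  assumes "a < b" and C: "{a<..<b} \<inter> C = {}"
    and "has_angle_change v C a b d" "has_angle_change v C a b d'"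
  shows "d = d'"
proof -
  obtain \<theta> where \<theta>: "continuous_on {a..b} \<theta>" "d = \<theta> b - \<theta> a"
      "\<And>x. x \<in> {a..b} - C \<Longrightarrow> v x = vector [cos (\<theta> x), sin (\<theta> x)]"
    using assms(3) unfolding has_angle_change_def by blast
  obtain \<eta> where \<eta>: "continuous_on {a..b} \<eta>" "d' = \<eta> b - \<eta> a"
      "\<And>x. x \<in> {a..b} - C \<Longrightarrow> v x = vector [cos (\<eta> x), sin (\<eta> x)]"
    using assms(4) unfolding has_angle_change_def by blast
  \<comment> \<open>The number of full turns by which the two angle functions differ.\<close>
  define f where "f x = (\<theta> x - \<eta> x) / (2 * pi)" for x
  have cont: "continuous_on {a..b} f"
    unfolding f_def by (intro continuous_intros \<theta> \<eta>) auto
  have int: "f x \<in> \<int>" if x: "x \<in> {a<..<b}" for x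
  proof -
    have "x \<in> {a..b} - C"
      using x C by auto
    then have "(vector [cos (\<theta> x), sin (\<theta> x)] :: real^2) = vector [cos (\<eta> x), sin (\<eta> x)]"
      using \<theta>(3) \<eta>(3) by metis
    then have "cos (\<theta> x) = cos (\<eta> x)" "sin (\<theta> x) = sin (\<eta> x)"
      by (metis vector_2(1), metis vector_2(2))
    then have "sin (\<theta> x) = sin (\<eta> x) \<and> cos (\<theta> x) = cos (\<eta> x)"
      by simp
    then obtain n where "n \<in> \<int>" "\<theta> x = \<eta> x + 2 * pi * n"
      by (metis sin_cos_eq_iff Ints_of_int)
    then show ?thesis
      by (simp add: f_def)
  qed
  have "f constant_on {a<..<b}"
  proof (rule continuous_discrete_range_constant)
    show "continuous_on {a<..<b} f"
      using cont by (rule continuous_on_subset) auto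
    \<comment> \<open>Distinct integers are at least 1 apart, so the continuous \<open>f\<close>
      cannot jump on the connected open interval.\<close>
    show "\<exists>e>0. \<forall>y. y \<in> {a<..<b} \<and> f y \<noteq> f x \<longrightarrow> e \<le> norm (f y - f x)"
      if "x \<in> {a<..<b}" for x
      using int that by (intro exI[of _ 1]) (auto intro!: Ints_nonzero_abs_ge1)
  qed simp
  then obtain c where c: "\<And>x. x \<in> {a<..<b} \<Longrightarrow> f x = c"
    unfolding constant_on_def by blast
  \<comment> \<open>The endpoints may lie in \<open>C\<close>, where \<open>v\<close> says nothing
    about the angles; there the value of \<open>f\<close> comes from continuity alone.\<close>
  have "f x = c" if "x \<in> {a..b}" for x
    by (rule continuous_constant_on_closure[of "{a<..<b}"]) (use c cont that \<open>a < b\<close> in auto)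
  then have "f a = f b"
    using \<open>a < b\<close> by simp
  then show ?thesis
    by (simp add: f_def \<theta>(2) \<eta>(2))
qed

lemma angle_change_eqI:
  assumes "a < b" "{a<..<b} \<inter> C = {}" "has_angle_change v C a b d"
  shows "angle_change v C a b = d"
  unfolding angle_change_def
  using assms has_angle_change_unique by blast

lemma cusp_params_disjoint_arc:
  assumes "strict_mono_on {..n} s" "j < n"
  shows "{s j<..<s (Suc j)} \<inter> cusp_params s n = {}"
proof -
  have False if "k \<le> n" "s j < s k" "s k < s (Suc j)" for k
    using that assms strict_mono_on_less[of "{..n}" s] by (auto simp: less_Suc_eq_le)
  then show ?thesis
    by (auto simp: cusp_params_def)
qed

text \<open>Every index \<open>k\<close> below \<open>j\<close> has
  \<open>s (Suc k) \<le> s j < x\<close>, so the \<open>LEAST\<close> operator picks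
  \<open>j\<close>. Values of \<open>s\<close> beyond \<open>n\<close>, where monotonicity is not
  known, never enter.\<close>

lemma alternating_tangent_on_arc:
  assumes "strict_mono_on {..n} s" "j < n" and x: "x \<in> {s j<..<s (Suc j)}"
  shows "alternating_tangent \<beta> s x = (-1) ^ j *\<^sub>R unit_tangent \<beta> x"
proof -
  have "(LEAST k. x < s (Suc k)) = j"
  proof (rule Least_equality)
    fix k assume k: "x < s (Suc k)"
    show "j \<le> k"
    proof (rule ccontr)
      assume "\<not> j \<le> k"
      then have "s (Suc k) \<le> s j"
        using assms strict_mono_on_leD[of "{..n}" s "Suc k" j] by auto
      then show False
        using k x by auto
    qed
  qed (use x in auto)
  then show ?thesis
    by (simp add: alternating_tangent_def)
qed

lemma angle_change_unit_tangent_arc: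
  assumes s: "strict_mono_on {..n} s" and j: "j < n"
    and cont: "continuous_on {s 0..s n} \<theta>"
    and \<theta>: "\<And>x. x \<in> {s 0..s n} - cusp_params s n \<Longrightarrow>
              alternating_tangent \<beta> s x = vector [cos (\<theta> x), sin (\<theta> x)]"
  shows "angle_change (unit_tangent \<beta>) (cusp_params s n) (s j) (s (Suc j)) = \<theta> (s (Suc j)) - \<theta> (s j)"
proof (rule angle_change_eqI)
  show "s j < s (Suc j)"
    using s j by (simp add: strict_mono_on_less)
  show disj: "{s j<..<s (Suc j)} \<inter> cusp_params s n = {}"
    using s j by (rule cusp_params_disjoint_arc)
  have sub: "{s j..s (Suc j)} \<subseteq> {s 0..s n}"
    using strict_mono_on_leD[OF s, of 0 j] strict_mono_on_leD[OF s, of "Suc j" n] j by auto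
  show "has_angle_change (unit_tangent \<beta>) (cusp_params s n) (s j) (s (Suc j))
          (\<theta> (s (Suc j)) - \<theta> (s j))"
    unfolding has_angle_change_def
  proof (intro exI conjI ballI)
    \<comment> \<open>Shifting by \<open>real j * pi\<close> multiplies cosine and sine by
      \<open>(-1) ^ j\<close>, the sign of the alternating tangent on this arc. Being constant, the
      shift leaves the angle change as it is.\<close>
    show "continuous_on {s j..s (Suc j)} (\<lambda>x. \<theta> x + real j * pi)"
      by (intro continuous_intros continuous_on_subset[OF cont sub])
    fix x assume x: "x \<in> {s j..s (Suc j)} - cusp_params s n"
    \<comment> \<open>Both ends of the arc are cusps, so \<open>x\<close> is interior and the sign
      there is \<open>(-1) ^ j\<close>.\<close>
    moreover have "s j \<in> cusp_params s n" "s (Suc j) \<in> cusp_params s n"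
      using j by (auto simp: cusp_params_def)
    ultimately have "x \<in> {s j<..<s (Suc j)}"
      by (metis DiffD1 DiffD2 atLeastAtMost_iff greaterThanLessThan_iff order_le_less)
    then have "(-1) ^ j *\<^sub>R unit_tangent \<beta> x = vector [cos (\<theta> x), sin (\<theta> x)]"
      using alternating_tangent_on_arc[OF s j] \<theta> x sub by (metis DiffD1 DiffD2 DiffI subsetD)
    \<comment> \<open>The sign is its own inverse, so a second multiplication isolates
      \<open>unit_tangent\<close>.\<close>
    then have "(-1) ^ j *\<^sub>R (-1) ^ j *\<^sub>R unit_tangent \<beta> x =
        (-1) ^ j *\<^sub>R (vector [cos (\<theta> x), sin (\<theta> x)] :: real^2)"
      by simp
    then have "unit_tangent \<beta> x = (-1) ^ j *\<^sub>R vector [cos (\<theta> x), sin (\<theta> x)]"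
      by (simp flip: power_mult_distrib)
    then show "unit_tangent \<beta> x = vector [cos (\<theta> x + real j * pi), sin (\<theta> x + real j * pi)]"
      by (simp add: vec_eq_iff forall_2 cos_add sin_add)
  qed simp
qed

theorem theorem2:
  fixes \<beta> :: "real \<Rightarrow> real^2" and s :: "nat \<Rightarrow> real" and n :: nat
  assumes "closed_cuspidal_curve \<beta> s n"
    and "even n"
    and "has_angle_change (alternating_tangent \<beta> s) (cusp_params s n) (s 0) (s n) (- 2 * pi)"
  shows "rotation_index \<beta> s n = (real n - 2) / 2"
proof -
  have s: "strict_mono_on {..n} s"
    using assms(1) by (simp add: closed_cuspidal_curve_def)
  obtain \<theta> where cont: "continuous_on {s 0..s n} \<theta>"
    and \<theta>: "\<And>x. x \<in> {s 0..s n} - cusp_params s n \<Longrightarrow>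
              alternating_tangent \<beta> s x = vector [cos (\<theta> x), sin (\<theta> x)]"
    and total: "\<theta> (s n) - \<theta> (s 0) = - 2 * pi"
    using assms(3) unfolding has_angle_change_def by metis
  \<comment> \<open>A single \<open>\<theta>\<close> serves all arcs and is continuous through the
    cusps, so neighbouring terms share their value at the common cusp.\<close>
  have "(\<Sum>j<n. angle_change (unit_tangent \<beta>) (cusp_params s n) (s j) (s (Suc j)))
      = (\<Sum>j<n. \<theta> (s (Suc j)) - \<theta> (s j))"
    using angle_change_unit_tangent_arc[OF s _ cont \<theta>] by (intro sum.cong) auto
  also have "\<dots> = - 2 * pi"
    using total by (simp add: sum_lessThan_telescope[of "\<lambda>j. \<theta> (s j)"])
  finally show ?thesis
    by (simp add: rotation_index_def field_simps)
qed

end
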